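(* Let $k\ge1$ and let $\theta_k$ be the bound defined in the context. Then the step size $$\gamma_k=\min\left\{\max I_k,\ \frac{1}{\left(\sqrt{\Delta\alpha_k^2+\frac14\|A^TA\Delta x_k\|^2}+|\Delta\alpha_k|+\theta_k\|\Delta x_k\|\right)\|D_{k-1}^{-1}\|}\right\}$$ fulfils both conditions $$\|E_k\|\,\|D_{k-1}^{-1}\|<1\qquad\text{and}\qquad \frac{\|D_{k-1}^{-1}\|}{1-\|E_k\|\,\|D_{k-1}^{-1}\|}\,\|M_k\|<1 .$$
   Context: $A\in\mathbb{R}^{m\times n}$, $b\in\mathbb{R}^m$ and $\varepsilon>0$ are given. $\|\cdot\|$ is the Euclidean norm for vectors and the induced (spectral) norm for matrices. The function $F=(F_1,F_2)$ is defined for $(x,\alpha)\in\mathbb{R}^n\times(0,\infty)$ by $$F_1(x,\alpha)=(A^TA+\alpha I)x-A^Tb,\qquad F_2(x,\alpha)=\tfrac12(Ax-b)^T(Ax-b)-\tfrac12\varepsilon^2 ,$$ with Jacobian $J(x,\alpha)=\begin{pmatrix}A^TA+\alpha I & x\\ (Ax-b)^TA & 0\end{pmatrix}$. Given the current iterate $(x_{k-1},\alpha_{k-1})\in\mathbb{R}^n\times(0,\infty)$, the Newton search direction $(\Delta x_k,\Delta\alpha_k)\in\mathbb{R}^n\times\mathbb{R}$ is the solution of $$J(x_{k-1},\alpha_{k-1})\begin{pmatrix}\Delta x_k\\ \Delta\alpha_k\end{pmatrix}=-F(x_{k-1},\alpha_{k-1}).$$ The iterates are generated by the scaled Newton iteration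 $x_k=x_{k-1}+\gamma_k\Delta x_k$, $\alpha_k=\alpha_{k-1}+\gamma_k\Delta\alpha_k$, started from a point $(x_0,\alpha_0)$ with $\alpha_0>0$ and $F_1(x_0,\alpha_0)=0$. A tolerance $\omega\in(0,1)$ is fixed and, in the following three cases only, the admissible set of step sizes $I_k$ and the number $\theta_k$ are defined by: - if $\Delta\alpha_k>0$: $I_k=(0,1]$ and $\theta_k=\sqrt2$; - if $\Delta\alpha_k<0$ and $\alpha_{k-1}+\Delta\alpha_k>0$: $I_k=(0,1]$ and $\theta_k=\sqrt{1+\left(\frac{\alpha_{k-1}}{\alpha_{k-1}+\Delta\alpha_k}\right)^2}$; - if $\Delta\alpha_k<0$ and $\alpha_{k-1}+\Delta\alpha_k<0$: $I_k=(0,-\omega\alpha_{k-1}/\Delta\alpha_k]$ and $\theta_k=\sqrt{1+\frac{1}{(1-\omega)^2}}$. With $\zeta_k=\alpha_{k-1}/(\alpha_{k-1}+\gamma_k\Delta\alpha_k)$, define the $(n+1)\times(n+1)$ matrices $$D_{k-1}=\begin{pmatrix}A^TA+\alpha_{k-1}I & x_{k-1}\\ -x_{k-1}^T & 0\end{pmatrix},\quad E_k=\gamma_k\begin{pmatrix}\Delta\alpha_k I & \Delta x_k\\ -\zeta_k\Delta x_k^T & 0\end{pmatrix},\quad M_k=\gamma_k\begin{pmatrix}\Delta\alpha_k I & 0\\ \tfrac12\Delta x_k^TA^TA & 0\end{pmatrix}.$$ It is a standing assumption that $x_{k-1}\neq0$, so that $D_{k-1}$ is invertible.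
   Formalization: For k ≥ 2 the search direction is additionally assumed to satisfy Δx_k ≠ 0; if Δx_k = 0 and the minimum is attained by its second argument, the second quantity equals exactly 1, so the strict inequality fails. *)

theory Defs
  imports "HOL-Analysis.Analysis"
begin

(* The index type 'n + 1 has CARD('n) + 1 elements: Inl i are the first n indices and
   the single Inr element is the last one. *)

definition bordered ::
  "real^'n^'n \<Rightarrow> real^'n \<Rightarrow> real^'n \<Rightarrow> real \<Rightarrow> real^('n::finite + 1)^('n + 1)"
  where "bordered B c r d =
    (\<chi> i j. case i of
        Inl i' \<Rightarrow> (case j of Inl j' \<Rightarrow> B $ i' $ j' | Inr _ \<Rightarrow> c $ i')
      | Inr _ \<Rightarrow> (case j of Inl j' \<Rightarrow> r $ j' | Inr _ \<Rightarrow> d))"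

definition append_scalar :: "real^'n \<Rightarrow> real \<Rightarrow> real^('n::finite + 1)"
  where "append_scalar v s = (\<chi> i. case i of Inl i' \<Rightarrow> v $ i' | Inr _ \<Rightarrow> s)"

definition spectral_norm :: "real^'a^'b \<Rightarrow> real"
  where "spectral_norm M = onorm ((*v) M)"

definition F1 :: "real^'n^'m \<Rightarrow> real^'m \<Rightarrow> real^'n \<Rightarrow> real \<Rightarrow> real^'n"
  where "F1 A b x \<alpha> = (transpose A ** A + mat \<alpha>) *v x - transpose A *v b"

definition F2 :: "real^'n^'m \<Rightarrow> real^'m \<Rightarrow> real \<Rightarrow> real^'n \<Rightarrow> real"
  where "F2 A b \<epsilon> x = 1/2 * ((A *v x - b) \<bullet> (A *v x - b)) - 1/2 * \<epsilon>\<^sup>2"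

definition jacobian ::
  "real^'n^'m \<Rightarrow> real^'m \<Rightarrow> real^'n \<Rightarrow> real \<Rightarrow> real^('n::finite + 1)^('n + 1)"
  where "jacobian A b x \<alpha> =
    bordered (transpose A ** A + mat \<alpha>) x ((A *v x - b) v* A) 0"

definition newton_direction ::
  "real^'n^'m \<Rightarrow> real^'m \<Rightarrow> real \<Rightarrow> real^'n \<Rightarrow> real \<Rightarrow> real^'n::finite \<Rightarrow> real \<Rightarrow> bool"
  where "newton_direction A b \<epsilon> x \<alpha> dx d\<alpha> \<longleftrightarrow>
    jacobian A b x \<alpha> *v append_scalar dx d\<alpha> = - append_scalar (F1 A b x \<alpha>) (F2 A b \<epsilon> x)"

(* The admissible step sizes and the bound are defined in three cases only; in the remaining
   cases (d\<alpha> = 0, or d\<alpha> < 0 and \<alpha> + d\<alpha> = 0) both are left unspecified. *)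

definition step_cases :: "real \<Rightarrow> real \<Rightarrow> bool"
  where "step_cases \<alpha> d\<alpha> \<longleftrightarrow>
    d\<alpha> > 0 \<or> (d\<alpha> < 0 \<and> \<alpha> + d\<alpha> > 0) \<or> (d\<alpha> < 0 \<and> \<alpha> + d\<alpha> < 0)"

definition step_set :: "real \<Rightarrow> real \<Rightarrow> real \<Rightarrow> real set"
  where "step_set \<omega> \<alpha> d\<alpha> =
    (if d\<alpha> > 0 then {0<..1}
     else if d\<alpha> < 0 \<and> \<alpha> + d\<alpha> > 0 then {0<..1}
     else if d\<alpha> < 0 \<and> \<alpha> + d\<alpha> < 0 then {0<.. - \<omega> * \<alpha> / d\<alpha>}
     else undefined)"

definition step_theta :: "real \<Rightarrow> real \<Rightarrow> real \<Rightarrow> real"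
  where "step_theta \<omega> \<alpha> d\<alpha> =
    (if d\<alpha> > 0 then sqrt 2
     else if d\<alpha> < 0 \<and> \<alpha> + d\<alpha> > 0 then sqrt (1 + (\<alpha> / (\<alpha> + d\<alpha>))\<^sup>2)
     else if d\<alpha> < 0 \<and> \<alpha> + d\<alpha> < 0 then sqrt (1 + 1 / (1 - \<omega>)\<^sup>2)
     else undefined)"

definition D_mat :: "real^'n^'m \<Rightarrow> real^'n \<Rightarrow> real \<Rightarrow> real^('n::finite + 1)^('n + 1)"
  where "D_mat A x \<alpha> = bordered (transpose A ** A + mat \<alpha>) x (- x) 0"

(* Here \<alpha> is the value before the step. *)
definition zeta :: "real \<Rightarrow> real \<Rightarrow> real \<Rightarrow> real"
  where "zeta \<alpha> \<gamma> d\<alpha> = \<alpha> / (\<alpha> + \<gamma> * d\<alpha>)"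

definition E_mat ::
  "real \<Rightarrow> real \<Rightarrow> real^'n \<Rightarrow> real \<Rightarrow> real^('n::finite + 1)^('n + 1)"
  where "E_mat \<alpha> \<gamma> dx d\<alpha> =
    \<gamma> *\<^sub>R bordered (mat d\<alpha>) dx (- (zeta \<alpha> \<gamma> d\<alpha> *\<^sub>R dx)) 0"

definition M_mat ::
  "real^'n^'m \<Rightarrow> real \<Rightarrow> real^'n \<Rightarrow> real \<Rightarrow> real^('n::finite + 1)^('n + 1)"
  where "M_mat A \<gamma> dx d\<alpha> =
    \<gamma> *\<^sub>R bordered (mat d\<alpha>) 0 ((1/2) *\<^sub>R (dx v* (transpose A ** A))) 0"

(* The sequences describe the scaled Newton iteration up to step k.  Index j of dx, d\<alpha>, \<gamma>
   belongs to the step from iterate j - 1 to iterate j, so the index 0 of these three is unused.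
   No choice of the step sizes is prescribed beyond the iterates before step k having
   a positive second component. *)
definition scaled_newton_iteration ::
  "real^'n^'m \<Rightarrow> real^'m \<Rightarrow> real \<Rightarrow> nat \<Rightarrow> (nat \<Rightarrow> real^'n) \<Rightarrow> (nat \<Rightarrow> real) \<Rightarrow>
    (nat \<Rightarrow> real^'n::finite) \<Rightarrow> (nat \<Rightarrow> real) \<Rightarrow> (nat \<Rightarrow> real) \<Rightarrow> bool"
  where "scaled_newton_iteration A b \<epsilon> k x \<alpha> dx d\<alpha> \<gamma> \<longleftrightarrow>
    \<alpha> 0 > 0 \<and> F1 A b (x 0) (\<alpha> 0) = 0 \<and>
    (\<forall>j<k. \<alpha> j > 0) \<and>
    (\<forall>j\<in>{1..k}. newton_direction A b \<epsilon> (x (j - 1)) (\<alpha> (j - 1)) (dx j) (d\<alpha> j) \<and>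
       x j = x (j - 1) + \<gamma> j *\<^sub>R dx j \<and> \<alpha> j = \<alpha> (j - 1) + \<gamma> j * d\<alpha> j)"

end

theory Submission
  imports Defs
begin

text \<open>
  Put \<open>N = \<parallel>D\<inverse>\<parallel>\<close>. Both inequalities follow at once from \<open>(\<parallel>E\<parallel> + \<parallel>M\<parallel>) N < 1\<close>.
  Up to the factor \<open>\<gamma>\<close>, the matrix \<open>E\<close> is the sum of a matrix with the single nonzero block
  \<open>\<Delta>\<alpha> I\<close> and one that exchanges the two blocks of a vector, and \<open>M\<close> has only one nonzero
  block column. Hence
  \<open>\<parallel>E\<parallel> \<le> \<gamma> (\<bar>\<Delta>\<alpha>\<bar> + max 1 \<bar>\<zeta>\<bar> \<parallel>\<Delta>x\<parallel>)\<close> and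
  \<open>\<parallel>M\<parallel> \<le> \<gamma> sqrt (\<Delta>\<alpha>\<^sup>2 + \<parallel>A\<^sup>T A \<Delta>x\<parallel>\<^sup>2 / 4)\<close>
  (lemmas \<open>spectral_norm_E_mat_le\<close> and \<open>spectral_norm_M_mat_le\<close>).

  The step size makes \<open>\<gamma> (sqrt (\<Delta>\<alpha>\<^sup>2 + \<parallel>A\<^sup>T A \<Delta>x\<parallel>\<^sup>2 / 4) + \<bar>\<Delta>\<alpha>\<bar> + \<theta> \<parallel>\<Delta>x\<parallel>) N\<close>
  at most 1, so what is missing is strictness. It comes from \<open>max 1 \<bar>\<zeta>\<bar> < sqrt (1 + \<zeta>\<^sup>2) \<le> \<theta>\<close>,
  where the second inequality is how the admissible step sizes and \<open>\<theta>\<close> are matched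
  (lemma \<open>max_zeta_less_step_theta\<close>), together with \<open>\<Delta>x \<noteq> 0\<close>. The latter is assumed
  in later steps; in the first step it is a consequence of \<open>F\<^sub>1(x\<^sub>0, \<alpha>\<^sub>0) = 0\<close>: if \<open>\<Delta>x\<close> vanished, the first block row of the Newton equation
  would read \<open>\<Delta>\<alpha> x\<^sub>0 = 0\<close>, although neither factor is zero
  (lemma \<open>newton_direction_zero_imp\<close>).
\<close>

lemma sum_UNIV_plus_one:
  fixes f :: "'n::finite + 1 \<Rightarrow> real"
  shows "sum f UNIV = (\<Sum>i\<in>UNIV. f (Inl i)) + f (Inr 1)"
  using sum.Plus[OF finite finite, of f UNIV UNIV]
  by (simp only: UNIV_Plus_UNIV comp_def sum_1)

lemma append_scalar_cases:
  obtains u s where "v = append_scalar u s"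
proof (rule that)
  show "v = append_scalar (\<chi> i. v $ Inl i) (v $ Inr 1)"
    by (simp add: append_scalar_def vec_eq_iff split_sum_all)
qed

lemma append_scalar_eq_iff:
  "append_scalar u s = append_scalar v t \<longleftrightarrow> u = v \<and> s = t"
  by (auto simp: append_scalar_def vec_eq_iff split_sum_all)

lemma minus_append_scalar:
  "- append_scalar u s = append_scalar (- u) (- s)"
  by (simp add: append_scalar_def vec_eq_iff split: sum.split)

lemma append_scalar_add:
  "append_scalar u s + append_scalar v t = append_scalar (u + v) (s + t)"
  by (simp add: append_scalar_def vec_eq_iff split: sum.split)

lemma norm_append_scalar:
  "norm (append_scalar u s) = sqrt ((norm u)\<^sup>2 + s\<^sup>2)"
  by (simp add: append_scalar_def norm_vec_def L2_set_def sum_UNIV_plus_one sum_nonneg)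

lemma norm_le_norm_append_scalar:
  "norm u \<le> norm (append_scalar u s)"
  by (simp add: norm_append_scalar real_le_rsqrt)

lemma bordered_mult_append_scalar:
  "bordered B c r d *v append_scalar u s = append_scalar (B *v u + s *\<^sub>R c) (r \<bullet> u + d * s)"
  by (simp add: bordered_def append_scalar_def vec_eq_iff matrix_vector_mult_def
      sum_UNIV_plus_one inner_vec_def split: sum.split)

lemma mat_mult_vector:
  "mat c *v (u :: real^'n) = c *\<^sub>R u"
proof -
  have "mat c = c *\<^sub>R (mat 1 :: real^'n^'n)"
    by (simp add: mat_def vec_eq_iff)
  then show ?thesis
    by (simp add: scaleR_matrix_vector_assoc[symmetric])
qed

lemma spectral_norm_scaleR_bordered_le:
  fixes B :: "real^'n::finite^'n"
  assumes "\<gamma> \<ge> 0"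
    and "\<And>u s. norm (append_scalar (B *v u + s *\<^sub>R c) (r \<bullet> u + d * s))
            \<le> K * norm (append_scalar u s)"
  shows "spectral_norm (\<gamma> *\<^sub>R bordered B c r d) \<le> \<gamma> * K"
  unfolding spectral_norm_def
proof (rule onorm_le)
  fix v :: "real^('n + 1)"
  obtain u s where "v = append_scalar u s"
    by (rule append_scalar_cases)
  then show "norm ((\<gamma> *\<^sub>R bordered B c r d) *v v) \<le> \<gamma> * K * norm v"
    using assms
    by (simp add: scaleR_matrix_vector_assoc[symmetric] bordered_mult_append_scalar
        mult.assoc mult_left_mono)
qed

text \<open>
  The off-diagonal part maps \<open>(u, s)\<close> to \<open>(s \<Delta>x, - \<zeta> \<Delta>x \<bullet> u)\<close>. As the two blocks of the image
  depend on different blocks of the argument, Cauchy-Schwarz gives the factor \<open>max 1 \<bar>\<zeta>\<bar>\<close>, which for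
  \<open>\<zeta> \<noteq> 0\<close> is strictly smaller than the factor \<open>sqrt (1 + \<zeta>\<^sup>2)\<close> that the Frobenius norm would give.
\<close>

lemma spectral_norm_E_mat_le:
  assumes "\<gamma> \<ge> 0"
  shows "spectral_norm (E_mat \<alpha> \<gamma> dx d\<alpha>) \<le> \<gamma> * (\<bar>d\<alpha>\<bar> + max 1 \<bar>zeta \<alpha> \<gamma> d\<alpha>\<bar> * norm dx)"
  unfolding E_mat_def
proof (rule spectral_norm_scaleR_bordered_le[OF assms])
  fix u :: "real^'a" and s :: real
  define z where "z = zeta \<alpha> \<gamma> d\<alpha>"
  define m where "m = max 1 \<bar>z\<bar>"
  have m: "m \<ge> 1" "\<bar>z\<bar> \<le> m"
    by (auto simp: m_def)
  have diag: "norm (append_scalar (d\<alpha> *\<^sub>R u) 0) \<le> \<bar>d\<alpha>\<bar> * norm (append_scalar u s)"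
    by (simp add: norm_append_scalar[of _ 0] mult_left_mono norm_le_norm_append_scalar)
  have "(norm (s *\<^sub>R dx))\<^sup>2 \<le> (m * (\<bar>s\<bar> * norm dx))\<^sup>2"
    using mult_right_mono[OF m(1), of "\<bar>s\<bar> * norm dx"] by (intro power_mono) auto
  moreover have "\<bar>z * (dx \<bullet> u)\<bar> \<le> m * (norm dx * norm u)"
    unfolding abs_mult using m by (intro mult_mono Cauchy_Schwarz_ineq2) auto
  then have "(z * (dx \<bullet> u))\<^sup>2 \<le> (m * (norm dx * norm u))\<^sup>2"
    by (rule power2_le_iff_abs_le[THEN iffD2, rotated]) (use m in auto)
  ultimately have "(norm (s *\<^sub>R dx))\<^sup>2 + (- (z * (dx \<bullet> u)))\<^sup>2
      \<le> (m * norm dx)\<^sup>2 * ((norm u)\<^sup>2 + s\<^sup>2)"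
    by (simp add: power_mult_distrib algebra_simps)
  then have "sqrt ((norm (s *\<^sub>R dx))\<^sup>2 + (- (z * (dx \<bullet> u)))\<^sup>2)
      \<le> sqrt ((m * norm dx)\<^sup>2 * ((norm u)\<^sup>2 + s\<^sup>2))"
    by (rule real_sqrt_le_mono)
  also have "\<dots> = m * norm dx * norm (append_scalar u s)"
    using m by (simp add: norm_append_scalar real_sqrt_mult)
  finally have "norm (append_scalar (s *\<^sub>R dx) (- (z * (dx \<bullet> u))))
      \<le> m * norm dx * norm (append_scalar u s)"
    unfolding norm_append_scalar[of "s *\<^sub>R dx"] .
  then have "norm (append_scalar (d\<alpha> *\<^sub>R u) 0 + append_scalar (s *\<^sub>R dx) (- (z * (dx \<bullet> u))))
      \<le> (\<bar>d\<alpha>\<bar> + m * norm dx) * norm (append_scalar u s)"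
    using diag unfolding distrib_right by (rule norm_triangle_mono[rotated])
  then show "norm (append_scalar (mat d\<alpha> *v u + s *\<^sub>R dx) (- (zeta \<alpha> \<gamma> d\<alpha> *\<^sub>R dx) \<bullet> u + 0 * s))
      \<le> (\<bar>d\<alpha>\<bar> + max 1 \<bar>zeta \<alpha> \<gamma> d\<alpha>\<bar> * norm dx) * norm (append_scalar u s)"
    by (simp add: append_scalar_add mat_mult_vector z_def m_def)
qed

lemma spectral_norm_M_mat_le:
  fixes A :: "real^'n^'m"
  assumes "\<gamma> \<ge> 0"
  shows "spectral_norm (M_mat A \<gamma> dx d\<alpha>)
    \<le> \<gamma> * sqrt (d\<alpha>\<^sup>2 + 1/4 * (norm ((transpose A ** A) *v dx))\<^sup>2)"
  unfolding M_mat_def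
proof (rule spectral_norm_scaleR_bordered_le[OF assms])
  fix u :: "real^'n" and s :: real
  define w where "w = (transpose A ** A) *v dx"
  have w: "dx v* (transpose A ** A) = w"
    unfolding w_def by (metis transpose_matrix_vector matrix_transpose_mul transpose_transpose)
  have "(w \<bullet> u)\<^sup>2 \<le> (norm w)\<^sup>2 * (norm u)\<^sup>2"
    using Cauchy_Schwarz_ineq[of w u] by (simp add: power2_norm_eq_inner)
  then have "(norm (d\<alpha> *\<^sub>R u))\<^sup>2 + (1/2 * (w \<bullet> u))\<^sup>2 \<le> (d\<alpha>\<^sup>2 + 1/4 * (norm w)\<^sup>2) * (norm u)\<^sup>2"
    by (simp add: power_mult_distrib algebra_simps power_divide)
  then have "norm (append_scalar (d\<alpha> *\<^sub>R u) (1/2 * (w \<bullet> u)))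
      \<le> sqrt ((d\<alpha>\<^sup>2 + 1/4 * (norm w)\<^sup>2) * (norm u)\<^sup>2)"
    unfolding norm_append_scalar by (rule real_sqrt_le_mono)
  also have "\<dots> = sqrt (d\<alpha>\<^sup>2 + 1/4 * (norm w)\<^sup>2) * norm u"
    by (simp add: real_sqrt_mult)
  also have "\<dots> \<le> sqrt (d\<alpha>\<^sup>2 + 1/4 * (norm w)\<^sup>2) * norm (append_scalar u s)"
    by (intro mult_left_mono norm_le_norm_append_scalar) simp
  finally show "norm (append_scalar (mat d\<alpha> *v u + s *\<^sub>R 0)
        ((1/2) *\<^sub>R (dx v* (transpose A ** A)) \<bullet> u + 0 * s))
      \<le> sqrt (d\<alpha>\<^sup>2 + 1/4 * (norm ((transpose A ** A) *v dx))\<^sup>2) * norm (append_scalar u s)"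
    by (simp add: w mat_mult_vector flip: w_def)
qed

lemma newton_direction_zero_imp:
  assumes "newton_direction A b \<epsilon> x \<alpha> 0 d\<alpha>" and "F1 A b x \<alpha> = 0" and "x \<noteq> 0"
  shows "d\<alpha> = 0"
  using assms
  by (auto simp: newton_direction_def jacobian_def bordered_mult_append_scalar
      minus_append_scalar append_scalar_eq_iff)

lemma step_set_eq_interval:
  assumes "0 < \<omega>" "0 < \<alpha>" "step_cases \<alpha> d\<alpha>"
  obtains g where "g > 0" "step_set \<omega> \<alpha> d\<alpha> = {0<..g}"
proof (cases "d\<alpha> < 0 \<and> \<alpha> + d\<alpha> < 0")
  case True
  then have "- \<omega> * \<alpha> / d\<alpha> > 0"
    using assms by (simp add: divide_pos_neg)
  with True show ?thesis
    by (intro that) (auto simp: step_set_def)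
next
  case False
  with assms that[of 1] show ?thesis
    by (auto simp: step_set_def step_cases_def)
qed

lemma Greatest_mem_step_set:
  assumes "0 < \<omega>" "0 < \<alpha>" "step_cases \<alpha> d\<alpha>"
  shows "(GREATEST g. g \<in> step_set \<omega> \<alpha> d\<alpha>) \<in> step_set \<omega> \<alpha> d\<alpha>"
proof -
  obtain g where "g > 0" "step_set \<omega> \<alpha> d\<alpha> = {0<..g}"
    using step_set_eq_interval[OF assms] .
  moreover from this have "(GREATEST g. g \<in> step_set \<omega> \<alpha> d\<alpha>) = g"
    by (intro Greatest_equality) auto
  ultimately show ?thesis
    by simp
qed

lemma step_set_downward_closed:
  assumes "0 < \<omega>" "0 < \<alpha>" "step_cases \<alpha> d\<alpha>" "g \<in> step_set \<omega> \<alpha> d\<alpha>" "0 < h" "h \<le> g"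
  shows "h \<in> step_set \<omega> \<alpha> d\<alpha>"
  using step_set_eq_interval[OF assms(1-3)] assms(4-6) by (metis greaterThanAtMost_iff order_trans)

text \<open>
  For an admissible step size the new value \<open>\<alpha> + \<gamma> \<Delta>\<alpha>\<close> is at least \<open>\<alpha>\<close>, \<open>\<alpha> + \<Delta>\<alpha>\<close> or
  \<open>(1 - \<omega>) \<alpha>\<close>, respectively, and \<open>\<theta>\<^sup>2 - 1\<close> is the square of the resulting upper bound on \<open>\<zeta>\<close>.
\<close>

lemma max_zeta_less_step_theta:
  assumes "0 < \<omega>" "\<omega> < 1" "0 < \<alpha>" "step_cases \<alpha> d\<alpha>" "\<gamma> \<in> step_set \<omega> \<alpha> d\<alpha>"
  shows "max 1 \<bar>zeta \<alpha> \<gamma> d\<alpha>\<bar> < step_theta \<omega> \<alpha> d\<alpha>"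
proof -
  define z where "z = zeta \<alpha> \<gamma> d\<alpha>"
  have bound: "0 < z \<and> z \<le> \<alpha> / l" if "0 < l" "l \<le> \<alpha> + \<gamma> * d\<alpha>" for l
    using that assms(3) by (auto simp: z_def zeta_def intro!: divide_left_mono)
  obtain q where q: "0 < z" "z \<le> q" "step_theta \<omega> \<alpha> d\<alpha> = sqrt (1 + q\<^sup>2)"
  proof -
    consider "d\<alpha> > 0" | "d\<alpha> < 0" "\<alpha> + d\<alpha> > 0" | "d\<alpha> < 0" "\<alpha> + d\<alpha> < 0"
      using assms(4) by (auto simp: step_cases_def)
    then show thesis
    proof cases
      case 1
      then have "\<gamma> > 0"
        using assms(5) by (simp add: step_set_def)
      with 1 show ?thesis
        using bound[of \<alpha>] assms(3) by (intro that[of 1]) (auto simp: step_theta_def)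
    next
      case 2
      then have "\<gamma> \<le> 1"
        using assms(5) by (simp add: step_set_def)
      then have "1 * d\<alpha> \<le> \<gamma> * d\<alpha>"
        using 2 by (intro mult_right_mono_neg) auto
      with 2 show ?thesis
        using bound[of "\<alpha> + d\<alpha>"] by (intro that[of "\<alpha> / (\<alpha> + d\<alpha>)"]) (auto simp: step_theta_def)
    next
      case 3
      then have "\<gamma> \<le> - \<omega> * \<alpha> / d\<alpha>"
        using assms(5) by (simp add: step_set_def)
      then have "- \<omega> * \<alpha> / d\<alpha> * d\<alpha> \<le> \<gamma> * d\<alpha>"
        using 3 by (intro mult_right_mono_neg) auto
      then have "(1 - \<omega>) * \<alpha> \<le> \<alpha> + \<gamma> * d\<alpha>"
        using 3 by (simp add: algebra_simps)
      with 3 show ?thesis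
        using bound[of "(1 - \<omega>) * \<alpha>"] assms(2,3)
        by (intro that[of "1 / (1 - \<omega>)"]) (auto simp: step_theta_def power_divide)
    qed
  qed
  have "max 1 \<bar>z\<bar> \<le> max 1 q"
    using q by auto
  also have "\<dots> < sqrt (1 + q\<^sup>2)"
    using q by (auto intro!: real_less_rsqrt)
  finally show ?thesis
    using q by (simp add: z_def)
qed

theorem corollary2p7:
  fixes A :: "real^'n^'m" and b :: "real^'m" and \<epsilon> \<omega> :: real and k :: nat
    and x dx :: "nat \<Rightarrow> real^'n" and \<alpha> d\<alpha> \<gamma> :: "nat \<Rightarrow> real"
  defines "D\<^sub>k \<equiv> D_mat A (x (k - 1)) (\<alpha> (k - 1))"
    and "E\<^sub>k \<equiv> E_mat (\<alpha> (k - 1)) (\<gamma> k) (dx k) (d\<alpha> k)"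
    and "M\<^sub>k \<equiv> M_mat A (\<gamma> k) (dx k) (d\<alpha> k)"
    and "I\<^sub>k \<equiv> step_set \<omega> (\<alpha> (k - 1)) (d\<alpha> k)"
    and "\<theta>\<^sub>k \<equiv> step_theta \<omega> (\<alpha> (k - 1)) (d\<alpha> k)"
  assumes "\<epsilon> > 0" and "0 < \<omega>" and "\<omega> < 1" and "k \<ge> 1"
    and "scaled_newton_iteration A b \<epsilon> k x \<alpha> dx d\<alpha> \<gamma>"
    and "x (k - 1) \<noteq> 0"
    and "step_cases (\<alpha> (k - 1)) (d\<alpha> k)"
    and "k = 1 \<or> dx k \<noteq> 0"
    and "\<gamma> k = min (GREATEST g. g \<in> I\<^sub>k)
           (1 / ((sqrt ((d\<alpha> k)\<^sup>2 + 1/4 * (norm ((transpose A ** A) *v dx k))\<^sup>2)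
                  + \<bar>d\<alpha> k\<bar> + \<theta>\<^sub>k * norm (dx k)) * spectral_norm (matrix_inv D\<^sub>k)))"
  shows "spectral_norm E\<^sub>k * spectral_norm (matrix_inv D\<^sub>k) < 1 \<and>
    spectral_norm (matrix_inv D\<^sub>k)
      / (1 - spectral_norm E\<^sub>k * spectral_norm (matrix_inv D\<^sub>k)) * spectral_norm M\<^sub>k < 1"
proof -
  define a where "a = \<alpha> (k - 1)"
  define e where "e = d\<alpha> k"
  define v where "v = dx k"
  define g where "g = \<gamma> k"
  define N where "N = spectral_norm (matrix_inv D\<^sub>k)"
  define S where "S = sqrt (e\<^sup>2 + 1/4 * (norm ((transpose A ** A) *v v))\<^sup>2)"
  define m where "m = max 1 \<bar>zeta a g e\<bar>"
  note it = assms(10)[unfolded scaled_newton_iteration_def]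
  have a: "a > 0"
    using it \<open>k \<ge> 1\<close> by (simp add: a_def)
  have cases: "step_cases a e"
    using assms(12) by (simp add: a_def e_def)
  have "v \<noteq> 0"
  proof
    assume "v = 0"
    then have "k = 1"
      using assms(13) by (simp add: v_def)
    then have "newton_direction A b \<epsilon> (x 0) (\<alpha> 0) 0 e" "F1 A b (x 0) (\<alpha> 0) = 0" "x 0 \<noteq> 0"
      using it \<open>v = 0\<close> assms(11) by (auto simp: v_def e_def)
    then have "e = 0"
      by (rule newton_direction_zero_imp)
    then show False
      using cases by (simp add: step_cases_def)
  qed
  have "N \<ge> 0"
    unfolding N_def spectral_norm_def by (intro onorm_pos_le) (rule matrix_vector_mul_bounded_linear)
  show ?thesis
    \<comment> \<open>The quotient that defines the step size is a division by zero when \<open>N = 0\<close>; then both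
        left-hand sides are zero.\<close>
  proof (cases "N = 0")
    case True
    then show ?thesis
      by (simp flip: N_def)
  next
    case False
    with \<open>N \<ge> 0\<close> have "N > 0"
      by simp
    define T where "T = S + \<bar>e\<bar> + \<theta>\<^sub>k * norm v"
    have gmax: "(GREATEST g. g \<in> I\<^sub>k) \<in> I\<^sub>k"
      using Greatest_mem_step_set[OF \<open>0 < \<omega>\<close> a cases] by (simp add: I\<^sub>k_def a_def e_def)
    have g: "g = min (GREATEST g. g \<in> I\<^sub>k) (1 / (T * N))"
      using assms(14) by (simp add: g_def T_def S_def N_def e_def v_def)
    have theta: "\<theta>\<^sub>k > 1"
      using max_zeta_less_step_theta[OF \<open>0 < \<omega>\<close> \<open>\<omega> < 1\<close> a cases] gmax
      by (fastforce simp: \<theta>\<^sub>k_def I\<^sub>k_def a_def e_def)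
    have "T > 0"
      using theta \<open>v \<noteq> 0\<close> by (simp add: T_def S_def add_nonneg_pos)
    have "(GREATEST g. g \<in> I\<^sub>k) > 0"
      using gmax step_set_eq_interval[OF \<open>0 < \<omega>\<close> a cases] unfolding I\<^sub>k_def a_def e_def
      by (metis greaterThanAtMost_iff)
    then have "g > 0"
      using \<open>T > 0\<close> \<open>N > 0\<close> by (simp add: g)
    then have "g \<in> I\<^sub>k"
      using step_set_downward_closed[OF \<open>0 < \<omega>\<close> a cases] gmax g
      unfolding I\<^sub>k_def a_def e_def by simp
    then have "m < \<theta>\<^sub>k"
      using max_zeta_less_step_theta[OF \<open>0 < \<omega>\<close> \<open>\<omega> < 1\<close> a cases, of g]
      by (simp add: m_def \<theta>\<^sub>k_def I\<^sub>k_def a_def e_def)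
    have E: "spectral_norm E\<^sub>k \<le> g * (\<bar>e\<bar> + m * norm v)"
      using spectral_norm_E_mat_le[of g a v e] \<open>g > 0\<close>
      by (simp add: E\<^sub>k_def m_def g_def a_def v_def e_def)
    have M: "spectral_norm M\<^sub>k \<le> g * S"
      using spectral_norm_M_mat_le[of g A v e] \<open>g > 0\<close>
      by (simp add: M\<^sub>k_def S_def g_def v_def e_def)
    have "spectral_norm M\<^sub>k \<ge> 0"
      unfolding spectral_norm_def by (intro onorm_pos_le) (rule matrix_vector_mul_bounded_linear)
    have "spectral_norm E\<^sub>k + spectral_norm M\<^sub>k \<le> g * (S + \<bar>e\<bar> + m * norm v)"
      using E M by (simp add: algebra_simps)
    also have "\<dots> < g * T"
      using \<open>g > 0\<close> \<open>m < \<theta>\<^sub>k\<close> \<open>v \<noteq> 0\<close> by (simp add: T_def)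
    finally have "(spectral_norm E\<^sub>k + spectral_norm M\<^sub>k) * N < g * T * N"
      using \<open>N > 0\<close> by (rule mult_strict_right_mono)
    also have "\<dots> \<le> 1 / (T * N) * (T * N)"
      using \<open>T > 0\<close> \<open>N > 0\<close> unfolding mult.assoc by (intro mult_right_mono) (auto simp: g)
    also have "\<dots> = 1"
      using \<open>T > 0\<close> \<open>N > 0\<close> by simp
    finally have sum: "spectral_norm E\<^sub>k * N + N * spectral_norm M\<^sub>k < 1"
      by (simp add: algebra_simps)
    then have "spectral_norm E\<^sub>k * N < 1"
      using mult_nonneg_nonneg[OF \<open>N \<ge> 0\<close> \<open>spectral_norm M\<^sub>k \<ge> 0\<close>] by linarith
    with sum show ?thesis
      by (simp add: divide_less_eq flip: N_def)
  qed
qed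

end
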